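(* Let $L,U\in\mathbb{R}^\eta$, $[L,U]=\{x\in\mathbb{R}^\eta:L_i\le x_i\le U_i\ \forall i\}$, and take an affine function $f(x)=w\cdot x+b$ over the input domain $[L,U]$, taking both a strictly positive and a strictly negative value on $[L,U]$. The following is an ideal MIP formulation for $\{(x,y)\in[L,U]\times\mathbb{R}: y=\max\{0,f(x)\}\}$: $$\text{(a)}\quad y\le\sum_{i\in I}w_i(x_i-\breve L_i(1-z))+\left(b+\sum_{i\notin I}w_i\breve U_i\right)z\quad\forall I\subseteq\{1,\dots,\eta\},$$ $$\text{(b)}\quad y\ge w\cdot x+b,\qquad\text{(c)}\quad(x,y,z)\in[L,U]\times\mathbb{R}_{\ge0}\times[0,1],\qquad\text{(d)}\quad z\in\{0,1\}.$$ Furthermore, each inequality in (a) and (b) is facet-defining.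
   Context: For each $i$: $\breve L_i=L_i$ and $\breve U_i=U_i$ if $w_i\ge0$; $\breve L_i=U_i$ and $\breve U_i=L_i$ if $w_i<0$. MIP terminology: a (valid) MIP formulation of $S\subseteq\mathbb{R}^{\eta+1}$ consists of linear constraints on $(x,y,z)\in\mathbb{R}^\eta\times\mathbb{R}\times\mathbb{R}^q$ defining a polyhedron $Q$ (its LP relaxation), together with $z\in\{0,1\}^q$, such that $S=\operatorname{Proj}_{x,y}(Q\cap(\mathbb{R}^{\eta+1}\times\{0,1\}^q))$. It is ideal if every extreme point of $Q$ lies in $\mathbb{R}^{\eta+1}\times\{0,1\}^q$. An inequality is valid if every point of $\underline Q=\{(x,y,z)\in Q: z\in\{0,1\}^q\}$ satisfies it; a valid inequality is facet-defining if the dimension of (the affine hull of) the points of $\underline Q$ satisfying it at equality is exactly one less than the dimension of (the affine hull of) $\underline Q$. *)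

theory Defs
  imports "HOL-Analysis.Analysis"
begin

text \<open>The space \<open>'z\<close> of integer variables is any Euclidean space: \<open>real ^ 'q\<close> for \<open>q\<close> binary
  variables, or just \<open>real\<close> (whose basis is \<open>{1}\<close>) for a single one.\<close>

definition binary_vectors :: "'z::euclidean_space set" where
  "binary_vectors = {z. \<forall>e\<in>Basis. z \<bullet> e \<in> {0, 1}}"

definition binary_points :: "((real ^ 'n) \<times> real \<times> 'z::euclidean_space) set
    \<Rightarrow> ((real ^ 'n) \<times> real \<times> 'z) set" where
  "binary_points Q = {(x, y, z) \<in> Q. z \<in> binary_vectors}"

definition mip_formulation :: "((real ^ 'n) \<times> real \<times> 'z::euclidean_space) set
    \<Rightarrow> ((real ^ 'n) \<times> real) set \<Rightarrow> bool" where
  "mip_formulation Q S \<longleftrightarrow>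
     polyhedron Q \<and> S = (\<lambda>(x, y, z). (x, y)) ` binary_points Q"

definition ideal_mip_formulation :: "((real ^ 'n) \<times> real \<times> 'z::euclidean_space) set
    \<Rightarrow> ((real ^ 'n) \<times> real) set \<Rightarrow> bool" where
  "ideal_mip_formulation Q S \<longleftrightarrow>
     mip_formulation Q S \<and> (\<forall>x y z. (x, y, z) extreme_point_of Q \<longrightarrow> z \<in> binary_vectors)"

text \<open>An inequality \<open>g p \<le> h p\<close> is represented by its two sides \<open>g\<close> and \<open>h\<close>. Validity and
  dimension refer to the binary points of \<open>Q\<close>, a set that is not convex in general, so the
  library's \<open>facet_of\<close> is not the right notion.\<close>

definition valid_inequality :: "((real ^ 'n) \<times> real \<times> 'z::euclidean_space) set
    \<Rightarrow> ((real ^ 'n) \<times> real \<times> 'z \<Rightarrow> real) \<Rightarrow> ((real ^ 'n) \<times> real \<times> 'z \<Rightarrow> real) \<Rightarrow> bool" where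
  "valid_inequality Q g h \<longleftrightarrow> (\<forall>p \<in> binary_points Q. g p \<le> h p)"

definition facet_defining :: "((real ^ 'n) \<times> real \<times> 'z::euclidean_space) set
    \<Rightarrow> ((real ^ 'n) \<times> real \<times> 'z \<Rightarrow> real) \<Rightarrow> ((real ^ 'n) \<times> real \<times> 'z \<Rightarrow> real) \<Rightarrow> bool" where
  "facet_defining Q g h \<longleftrightarrow>
     valid_inequality Q g h \<and>
     aff_dim {p \<in> binary_points Q. g p = h p} = aff_dim (binary_points Q) - 1"

definition breve_L :: "real ^ 'n \<Rightarrow> real ^ 'n \<Rightarrow> real ^ 'n \<Rightarrow> real ^ 'n" where
  "breve_L w L U = (\<chi> i. if w $ i \<ge> 0 then L $ i else U $ i)"

definition breve_U :: "real ^ 'n \<Rightarrow> real ^ 'n \<Rightarrow> real ^ 'n \<Rightarrow> real ^ 'n" where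
  "breve_U w L U = (\<chi> i. if w $ i \<ge> 0 then U $ i else L $ i)"

definition relu_upper :: "real ^ 'n \<Rightarrow> real ^ 'n \<Rightarrow> real ^ 'n \<Rightarrow> real \<Rightarrow> 'n set
    \<Rightarrow> real ^ 'n \<Rightarrow> real \<Rightarrow> real" where
  "relu_upper L U w b I x z =
     (\<Sum>i\<in>I. w $ i * (x $ i - breve_L w L U $ i * (1 - z)))
     + (b + (\<Sum>i\<in>-I. w $ i * breve_U w L U $ i)) * z"

definition relu_relaxation :: "real ^ 'n \<Rightarrow> real ^ 'n \<Rightarrow> real ^ 'n \<Rightarrow> real
    \<Rightarrow> ((real ^ 'n) \<times> real \<times> real) set" where
  "relu_relaxation L U w b =
     {(x, y, z). (\<forall>I. y \<le> relu_upper L U w b I x z) \<and>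
                 w \<bullet> x + b \<le> y \<and>
                 x \<in> cbox L U \<and> 0 \<le> y \<and> z \<in> {0..1}}"

end

theory Submission
  imports Defs
begin

text \<open>
  A point \<open>(x, y, z)\<close> of the relaxation with \<open>0 < z < 1\<close> is a proper convex combination of
  \<open>((x - u) / (1 - z), 0, 0)\<close> and \<open>(u / z, y / z, 1)\<close> as soon as both \<open>u / z\<close> and
  \<open>(x - u) / (1 - z)\<close> lie in the box and \<open>w \<bullet> u + b z = y\<close>. Such a \<open>u\<close> is found on a segment:
  at \<open>u = z x\<close> the left-hand side is \<open>z f x \<le> y\<close>, and its maximum over all admissible \<open>u\<close>
  is the right-hand side of (a) for a suitable \<open>I\<close>, hence at least \<open>y\<close>. So no such point is
  extreme. For the facets, translating a binary point along the \<open>y\<close>-axis moves it into the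
  affine hull of the tight points, so that hull has codimension at most one.
\<close>

section \<open>A criterion for facets of sets of binary points\<close>

text \<open>By \<open>shift\<close>, the tight hull and the direction \<open>e\<close> together
  reach every binary point. A binary point \<open>p\<close> off the hyperplane supplies that
  direction, so adding \<open>p\<close> to the tight points already spans everything and raises the
  dimension by exactly one.\<close>

lemma facet_definingI:
  fixes Q :: "((real ^ 'n) \<times> real \<times> 'z::euclidean_space) set"
  assumes valid: "valid_inequality Q g h"
    and aff: "affine {p. g p = h p}"
    and ex: "\<exists>p \<in> binary_points Q. g p \<noteq> h p"
    and shift: "\<And>q. q \<in> binary_points Q \<Longrightarrow>
      \<exists>s. q + s *\<^sub>R e \<in> affine hull {p \<in> binary_points Q. g p = h p}"
  shows "facet_defining Q g h"
proof -
  let ?B = "binary_points Q" and ?T = "{p \<in> binary_points Q. g p = h p}"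
  obtain p where p: "p \<in> ?B" "g p \<noteq> h p"
    using ex by blast
  have "affine hull ?T \<subseteq> {p. g p = h p}"
    using aff by (intro hull_minimal) auto
  then have p_notin: "p \<notin> affine hull ?T"
    using p by blast
  let ?A = "affine hull (insert p ?T)"
  have TA: "affine hull ?T \<subseteq> ?A" and pA: "p \<in> ?A"
    by (auto intro!: hull_mono hull_inc)
  obtain s where s: "p + s *\<^sub>R e \<in> affine hull ?T"
    using shift[OF p(1)] by blast
  then have "s \<noteq> 0"
    using p_notin by auto
  have "q \<in> ?A" if q: "q \<in> ?B" for q
  proof -
    obtain r where r: "q + r *\<^sub>R e \<in> affine hull ?T"
      using shift[OF q] by blast
    \<comment> \<open>The coefficients sum to one; the two terms with \<open>p\<close> add up to
      \<open>- r *\<^sub>R e\<close>, which undoes the shift of \<open>q\<close>.\<close>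
    have "1 *\<^sub>R (q + r *\<^sub>R e) + (r / s) *\<^sub>R p + (- r / s) *\<^sub>R (p + s *\<^sub>R e) \<in> ?A"
      using r s TA pA by (intro mem_affine_3) auto
    also have "1 *\<^sub>R (q + r *\<^sub>R e) + (r / s) *\<^sub>R p + (- r / s) *\<^sub>R (p + s *\<^sub>R e) = q"
      using \<open>s \<noteq> 0\<close> by (simp add: algebra_simps)
    finally show ?thesis .
  qed
  then have "affine hull ?B \<subseteq> ?A"
    by (intro hull_minimal) auto
  moreover have "?A \<subseteq> affine hull ?B"
    using p by (intro hull_mono) auto
  ultimately have "affine hull ?B = ?A"
    by (rule subset_antisym)
  then have "aff_dim ?B = aff_dim (insert p ?T)"
    by (rule aff_dim_affine_hull2)
  then show ?thesis
    using valid p_notin by (simp add: facet_defining_def aff_dim_insert)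
qed

section \<open>Box bounds and the right-hand side of (a)\<close>

lemma breve_in_cbox:
  assumes "cbox L U \<noteq> {}"
  shows "breve_L w L U \<in> cbox L U" "breve_U w L U \<in> cbox L U"
proof -
  have "L $ i \<le> U $ i" for i
    using assms by (metis ex_in_conv mem_box_cart(2) order_trans)
  then show "breve_L w L U \<in> cbox L U" "breve_U w L U \<in> cbox L U"
    by (auto simp: mem_box_cart breve_L_def breve_U_def)
qed

lemma breve_bounds:
  assumes "x \<in> cbox L U"
  shows "w $ i * breve_L w L U $ i \<le> w $ i * x $ i" "w $ i * x $ i \<le> w $ i * breve_U w L U $ i"
  using assms by (auto simp: mem_box_cart breve_L_def breve_U_def mult_left_mono mult_left_mono_neg)

lemma inner_breve_bounds:
  assumes "x \<in> cbox L U"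
  shows "w \<bullet> breve_L w L U \<le> w \<bullet> x" "w \<bullet> x \<le> w \<bullet> breve_U w L U"
  using breve_bounds[OF assms] by (auto simp: inner_vec_def intro!: sum_mono)

text \<open>Collecting the products with \<open>1 - z\<close> leaves coefficients independent of the
  point. Hence (a) is a half-space, as polyhedrality requires, and its tight set is a hyperplane, as
  the facet criterion requires.\<close>

lemma relu_upper_affine:
  obtains a \<beta> where "\<And>x y z. y - relu_upper L U w b I x z = a \<bullet> (x, y, z) - \<beta>"
proof
  fix x y z
  let ?\<beta> = "\<Sum>i\<in>I. w $ i * breve_L w L U $ i"
  have "(\<chi> i. if i \<in> I then w $ i else 0) \<bullet> x = (\<Sum>i\<in>I. w $ i * x $ i)"
    by (simp add: inner_vec_def if_distrib[of "\<lambda>a. a * _"] sum.If_cases)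
  then show "y - relu_upper L U w b I x z =
      (- (\<chi> i. if i \<in> I then w $ i else 0), 1, - (?\<beta> + b + (\<Sum>i\<in>-I. w $ i * breve_U w L U $ i)))
        \<bullet> (x, y, z) - (- ?\<beta>)"
    by (simp add: relu_upper_def algebra_simps sum.distrib sum_subtractf sum_distrib_left)
qed

lemma relu_upper_0:
  "relu_upper L U w b I x 0 = (\<Sum>i\<in>I. w $ i * x $ i - w $ i * breve_L w L U $ i)"
  by (simp add: relu_upper_def algebra_simps)

lemma relu_upper_1:
  "relu_upper L U w b I x 1 = w \<bullet> x + b + (\<Sum>i\<in>-I. w $ i * breve_U w L U $ i - w $ i * x $ i)"
proof -
  have "w \<bullet> x = (\<Sum>i\<in>I. w $ i * x $ i) + (\<Sum>i\<in>-I. w $ i * x $ i)"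
    using sum.union_disjoint[of I "-I" "\<lambda>i. w $ i * x $ i"] by (simp add: inner_vec_def)
  then show ?thesis
    by (simp add: relu_upper_def sum_subtractf)
qed

section \<open>The slices \<open>z = 0\<close> and \<open>z = 1\<close>, and polyhedrality\<close>

text \<open>At \<open>z = 0\<close> the strongest case of (a) is \<open>I = {}\<close>, which reads
  \<open>y \<le> 0\<close>; any other \<open>I\<close> only adds nonnegative terms.\<close>

lemma relu_relaxation_0:
  "(x, y, 0) \<in> relu_relaxation L U w b \<longleftrightarrow> x \<in> cbox L U \<and> y = 0 \<and> w \<bullet> x + b \<le> 0"
proof
  assume *: "(x, y, 0) \<in> relu_relaxation L U w b"
  then have "y \<le> relu_upper L U w b {} x 0"
    by (simp add: relu_relaxation_def)
  with * show "x \<in> cbox L U \<and> y = 0 \<and> w \<bullet> x + b \<le> 0"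
    by (auto simp: relu_relaxation_def relu_upper_0)
qed (auto simp: relu_relaxation_def relu_upper_0 breve_bounds intro!: sum_nonneg)

text \<open>At \<open>z = 1\<close> the strongest case of (a) is \<open>I = UNIV\<close>, which
  meets (b) from above; any other \<open>I\<close> adds nonnegative terms over
  \<open>-I\<close>.\<close>

lemma relu_relaxation_1:
  "(x, y, 1) \<in> relu_relaxation L U w b \<longleftrightarrow> x \<in> cbox L U \<and> y = w \<bullet> x + b \<and> 0 \<le> w \<bullet> x + b"
proof
  assume *: "(x, y, 1) \<in> relu_relaxation L U w b"
  then have "y \<le> relu_upper L U w b UNIV x 1"
    by (simp add: relu_relaxation_def)
  with * show "x \<in> cbox L U \<and> y = w \<bullet> x + b \<and> 0 \<le> w \<bullet> x + b"
    by (auto simp: relu_relaxation_def relu_upper_1)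
qed (auto simp: relu_relaxation_def relu_upper_1 breve_bounds intro!: sum_nonneg)

lemma binary_vectors_real: "binary_vectors = {0, 1 :: real}"
  by (auto simp: binary_vectors_def)

lemma binary_points_relu_relaxation:
  "binary_points (relu_relaxation L U w b) =
     {(x, y, z). x \<in> cbox L U \<and>
        (z = 0 \<and> y = 0 \<and> w \<bullet> x + b \<le> 0 \<or> z = 1 \<and> y = w \<bullet> x + b \<and> 0 \<le> w \<bullet> x + b)}"
  using relu_relaxation_0 relu_relaxation_1
  by (auto simp: binary_points_def binary_vectors_real; blast)

text \<open>Subsets and coordinates are indexed by finite types, so both families \<open>H\<close>
  and \<open>C\<close> are finite and the intersection of half-spaces is too.\<close>

lemma polyhedron_relu_relaxation:
  fixes L U w :: "real ^ 'n"
  shows "polyhedron (relu_relaxation L U w b)"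
proof -
  define H where "H = (\<lambda>I. {(x, y, z). y \<le> relu_upper L U w b I x z})"
  define C where "C = (\<lambda>i. {p :: (real ^ 'n) \<times> real \<times> real. (axis i 1, 0, 0) \<bullet> p \<le> U $ i} \<inter>
    {p. (axis i 1, 0, 0) \<bullet> p \<ge> L $ i})"
  have "relu_relaxation L U w b =
      (\<Inter>(range H) \<inter> \<Inter>(range C)) \<inter>
      ({p. (w, -1, 0) \<bullet> p \<le> - b} \<inter> {p. (0, 1, 0) \<bullet> p \<ge> 0} \<inter>
       {p. (0, 0, 1) \<bullet> p \<ge> 0} \<inter> {p. (0, 0, 1) \<bullet> p \<le> 1})"
    by (auto simp: relu_relaxation_def H_def C_def mem_box_cart cart_eq_inner_axis inner_commute
        algebra_simps)
  moreover have "polyhedron (H I)" for I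
  proof -
    obtain a \<beta> where "\<And>x y z. y - relu_upper L U w b I x z = a \<bullet> (x, y, z) - \<beta>"
      using relu_upper_affine by blast
    then have "y \<le> relu_upper L U w b I x z \<longleftrightarrow> a \<bullet> (x, y, z) \<le> \<beta>" for x y z
      by (metis diff_le_0_iff_le)
    then have "H I = {p. a \<bullet> p \<le> \<beta>}"
      by (auto simp: H_def)
    then show ?thesis
      by (simp add: polyhedron_halfspace_le)
  qed
  moreover have "polyhedron (C i)" for i
    by (simp add: C_def polyhedron_halfspace_le polyhedron_halfspace_ge)
  ultimately show ?thesis
    by (auto intro!: polyhedron_Int polyhedron_Inter polyhedron_halfspace_le polyhedron_halfspace_ge)
qed

section \<open>Splitting fractional points, and ideality\<close>

text \<open>The constraints on \<open>u\<close> separate by coordinate, so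
  \<open>w \<bullet> u\<close> is maximised coordinatewise. Each coordinate stops at one of two
  bounds, and \<open>I\<close> records which; this is where the index sets in (a) come from.\<close>

lemma relu_upper_attained:
  fixes L U w x :: "real ^ 'n"
  assumes x: "x \<in> cbox L U" and z: "0 < z" "z < 1"
  obtains u I where "u \<in> cbox (z *\<^sub>R L) (z *\<^sub>R U)"
    "x - u \<in> cbox ((1 - z) *\<^sub>R L) ((1 - z) *\<^sub>R U)"
    "w \<bullet> u + b * z = relu_upper L U w b I x z"
proof
  define u where "u = (\<chi> i. if w $ i \<ge> 0 then min (x $ i - L $ i * (1 - z)) (U $ i * z)
    else max (x $ i - U $ i * (1 - z)) (L $ i * z))"
  \<comment> \<open>Coordinates in \<open>I\<close> are stopped by the box for \<open>x - u\<close>,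
    the others by the box for \<open>u\<close>; ties go to \<open>I\<close>.\<close>
  define I where "I = {i. u $ i = x $ i - breve_L w L U $ i * (1 - z)}"
  have bd: "L $ i \<le> x $ i" "x $ i \<le> U $ i" for i
    using x by (auto simp: mem_box_cart)
  have mul: "L $ i * z \<le> U $ i * z" "L $ i * (1 - z) \<le> U $ i * (1 - z)" for i
    using z order_trans[OF bd] by (auto intro!: mult_right_mono)
  have u: "L $ i * z \<le> u $ i \<and> u $ i \<le> U $ i * z \<and>
    L $ i * (1 - z) \<le> x $ i - u $ i \<and> x $ i - u $ i \<le> U $ i * (1 - z)" for i
    using bd[of i] mul[of i] by (auto simp: u_def min_def max_def algebra_simps)
  show "u \<in> cbox (z *\<^sub>R L) (z *\<^sub>R U)" "x - u \<in> cbox ((1 - z) *\<^sub>R L) ((1 - z) *\<^sub>R U)"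
    using u by (simp_all add: mem_box_cart mult.commute)
  have notI: "u $ i = breve_U w L U $ i * z" if "i \<in> -I" for i
    using that by (auto simp: I_def u_def breve_L_def breve_U_def min_def max_def split: if_splits)
  have "w \<bullet> u = (\<Sum>i\<in>I. w $ i * u $ i) + (\<Sum>i\<in>-I. w $ i * u $ i)"
    using sum.union_disjoint[of I "-I" "\<lambda>i. w $ i * u $ i"] by (simp add: inner_vec_def)
  also have "(\<Sum>i\<in>I. w $ i * u $ i) = (\<Sum>i\<in>I. w $ i * (x $ i - breve_L w L U $ i * (1 - z)))"
    by (auto simp: I_def)
  also have "(\<Sum>i\<in>-I. w $ i * u $ i) = (\<Sum>i\<in>-I. w $ i * breve_U w L U $ i) * z"
    using notI by (simp add: sum_distrib_right mult.assoc)
  finally show "w \<bullet> u + b * z = relu_upper L U w b I x z"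
    by (simp add: relu_upper_def algebra_simps)
qed

lemma scaled_in_cbox:
  fixes v :: "real ^ 'n"
  assumes "v \<in> cbox (c *\<^sub>R L) (c *\<^sub>R U)" "0 < c"
  shows "(1 / c) *\<^sub>R v \<in> cbox L U"
  using assms by (auto simp: mem_box_cart field_simps)

lemma relu_relaxation_split:
  fixes L U w x :: "real ^ 'n"
  assumes Q: "(x, y, z) \<in> relu_relaxation L U w b" and z: "0 < z" "z < 1"
  obtains p q where "p \<in> relu_relaxation L U w b" "q \<in> relu_relaxation L U w b"
    "(x, y, z) \<in> open_segment p q"
proof -
  have x: "x \<in> cbox L U" and y: "0 \<le> y" "w \<bullet> x + b \<le> y"
    and up: "\<And>I. y \<le> relu_upper L U w b I x z"
    using Q by (auto simp: relu_relaxation_def)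
  obtain u I where u: "u \<in> cbox (z *\<^sub>R L) (z *\<^sub>R U)"
    "x - u \<in> cbox ((1 - z) *\<^sub>R L) ((1 - z) *\<^sub>R U)"
    "w \<bullet> u + b * z = relu_upper L U w b I x z"
    using relu_upper_attained[OF x z] by blast
  have "(1 - z) * L $ i \<le> (1 - z) * x $ i" "(1 - z) * x $ i \<le> (1 - z) * U $ i" for i
    using x z by (auto simp: mem_box_cart)
  then have zx: "z *\<^sub>R x \<in> cbox (z *\<^sub>R L) (z *\<^sub>R U)"
    "x - z *\<^sub>R x \<in> cbox ((1 - z) *\<^sub>R L) ((1 - z) *\<^sub>R U)"
    using x z by (auto simp: mem_box_cart left_diff_distrib)
  \<comment> \<open>If \<open>f x\<close> is nonnegative, then
    \<open>z * f x \<le> f x \<le> y\<close>; otherwise \<open>z * f x \<le> 0 \<le> y\<close>. Both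
    lower bounds on \<open>y\<close> are needed here.\<close>
  have "z * (w \<bullet> x + b) \<le> y"
  proof (cases "0 \<le> w \<bullet> x + b")
    case True
    then show ?thesis
      using y z by (intro order_trans[OF mult_left_le_one_le]) auto
  next
    case False
    then show ?thesis
      using y z by (intro order_trans[OF mult_nonneg_nonpos]) auto
  qed
  moreover define c where "c = z * (w \<bullet> x + b)"
  moreover define d where "d = w \<bullet> u + b * z"
  ultimately have cd: "c \<le> y" "y \<le> d"
    using up[of I] u(3) by auto
  obtain t where t: "0 \<le> t" "t \<le> 1" "(1 - t) * c + t * d = y"
  proof (cases "c = d")
    case True
    then show ?thesis
      using that[of 0] cd by simp
  next
    case False
    define s where "s = (y - c) / (d - c)"
    have s: "0 \<le> s" "s \<le> 1" "s * (d - c) = y - c"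
      using False cd by (auto simp: s_def)
    then have "(1 - s) * c + s * d = y"
      by (simp add: algebra_simps)
    then show ?thesis
      using that s by blast
  qed
  \<comment> \<open>This point of the segment from \<open>z *\<^sub>R x\<close> to \<open>u\<close>
    inherits both box constraints by convexity, and \<open>t\<close> is chosen so that
    \<open>w \<bullet> v + b * z\<close> is exactly \<open>y\<close>.\<close>
  define v where "v = (1 - t) *\<^sub>R (z *\<^sub>R x) + t *\<^sub>R u"
  have v: "v \<in> cbox (z *\<^sub>R L) (z *\<^sub>R U)"
    unfolding v_def using t u zx by (intro convexD convex_box) auto
  have "(1 - t) *\<^sub>R (x - z *\<^sub>R x) + t *\<^sub>R (x - u) \<in> cbox ((1 - z) *\<^sub>R L) ((1 - z) *\<^sub>R U)"
    using t u zx by (intro convexD convex_box) auto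
  also have "(1 - t) *\<^sub>R (x - z *\<^sub>R x) + t *\<^sub>R (x - u) = x - v"
    by (simp add: v_def algebra_simps)
  finally have xv: "x - v \<in> cbox ((1 - z) *\<^sub>R L) ((1 - z) *\<^sub>R U)" .
  have wv: "w \<bullet> v + b * z = y"
    using t(3) by (simp add: v_def c_def d_def algebra_simps)
  let ?p = "((1 / (1 - z)) *\<^sub>R (x - v), 0, 0) :: (real ^ 'n) \<times> real \<times> real"
  let ?q = "((1 / z) *\<^sub>R v, y / z, 1) :: (real ^ 'n) \<times> real \<times> real"
  have "w \<bullet> (x - v) = (w \<bullet> x + b - y) - b * (1 - z)"
    using wv by (simp add: algebra_simps)
  \<comment> \<open>The value of \<open>f\<close> at the endpoint with \<open>z = 0\<close> is
    nonpositive precisely because of (b).\<close>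
  then have "w \<bullet> ((1 / (1 - z)) *\<^sub>R (x - v)) + b = (w \<bullet> x + b - y) / (1 - z)"
    using z by (simp add: diff_divide_distrib[of _ "b * (1 - z)"])
  then have "?p \<in> relu_relaxation L U w b"
    using scaled_in_cbox[OF xv] z y by (simp add: relu_relaxation_0 divide_nonpos_pos)
  moreover have "w \<bullet> ((1 / z) *\<^sub>R v) + b = y / z"
    using z wv by (simp add: field_simps)
  then have "?q \<in> relu_relaxation L U w b"
    using scaled_in_cbox[OF v] z y by (simp add: relu_relaxation_1)
  moreover have "(x, y, z) = (1 - z) *\<^sub>R ?p + z *\<^sub>R ?q"
    using z by simp
  \<comment> \<open>The endpoints differ in the last coordinate, so the segment is not
    degenerate.\<close>
  then have "(x, y, z) \<in> open_segment ?p ?q"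
    using z unfolding in_segment by auto
  ultimately show ?thesis
    using that by blast
qed

lemma ideal_relu_relaxation:
  "ideal_mip_formulation (relu_relaxation L U w b)
     {(x, y). x \<in> cbox L U \<and> y = max 0 (w \<bullet> x + b)}"
proof -
  have "{(x, y). x \<in> cbox L U \<and> y = max 0 (w \<bullet> x + b)} =
      (\<lambda>(x, y, z). (x, y)) ` binary_points (relu_relaxation L U w b)"
  proof (intro subset_antisym subsetI)
    fix p assume "p \<in> {(x, y). x \<in> cbox L U \<and> y = max 0 (w \<bullet> x + b)}"
    then obtain x where x: "p = (x, max 0 (w \<bullet> x + b))" "x \<in> cbox L U"
      by auto
    then show "p \<in> (\<lambda>(x, y, z). (x, y)) ` binary_points (relu_relaxation L U w b)"
      \<comment> \<open>Where \<open>f\<close> vanishes both values of \<open>z\<close> are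
        admissible; the witness takes 0.\<close>
      by (intro image_eqI[of _ _ "(x, max 0 (w \<bullet> x + b), if w \<bullet> x + b \<le> 0 then 0 else 1)"])
        (auto simp: binary_points_relu_relaxation)
  qed (auto simp: binary_points_relu_relaxation)
  moreover have "z \<in> binary_vectors" if "(x, y, z) extreme_point_of relu_relaxation L U w b" for x y z
  proof (rule ccontr)
    assume "z \<notin> binary_vectors"
    moreover have Q: "(x, y, z) \<in> relu_relaxation L U w b"
      using that by (simp add: extreme_point_of_def)
    ultimately have "0 < z" "z < 1"
      by (auto simp: binary_vectors_real relu_relaxation_def)
    then show False
      by (rule relu_relaxation_split[OF Q]) (use that in \<open>auto simp: extreme_point_of_def\<close>)
  qed
  ultimately show ?thesis
    by (simp add: ideal_mip_formulation_def mip_formulation_def polyhedron_relu_relaxation)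
qed

section \<open>Affine hulls of tight points, and the facets\<close>

text \<open>The sign condition removes nothing of \<open>C\<close> near \<open>c\<close>, so it does not shrink the affine hull.\<close>

lemma affine_contains_of_nonneg:
  fixes c x w :: "'a::real_inner"
  assumes S: "affine S" and c: "0 < w \<bullet> c + b"
    and C: "convex C" "c \<in> C" "x \<in> C"
    and mem: "\<And>v. v \<in> C \<Longrightarrow> 0 \<le> w \<bullet> v + b \<Longrightarrow> (v, a * (w \<bullet> v + b), z) \<in> S"
  shows "(x, a * (w \<bullet> x + b), z) \<in> S"
proof -
  \<comment> \<open>Chosen to balance \<open>(1 - \<epsilon>) * (w \<bullet> c + b)\<close> against
    \<open>\<epsilon> * \<bar>w \<bullet> x + b\<bar>\<close>, so that moving from \<open>c\<close>
    towards \<open>x\<close> by this fraction keeps the affine function nonnegative.\<close>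
  define \<epsilon> where "\<epsilon> = (w \<bullet> c + b) / (w \<bullet> c + b + \<bar>w \<bullet> x + b\<bar>)"
  have \<epsilon>: "0 < \<epsilon>" "\<epsilon> \<le> 1"
    using c by (auto simp: \<epsilon>_def field_simps)
  define v where "v = (1 - \<epsilon>) *\<^sub>R c + \<epsilon> *\<^sub>R x"
  have wv: "w \<bullet> v + b = (1 - \<epsilon>) * (w \<bullet> c + b) + \<epsilon> * (w \<bullet> x + b)"
    by (simp add: v_def algebra_simps)
  have "(1 - \<epsilon>) * (w \<bullet> c + b) = \<epsilon> * \<bar>w \<bullet> x + b\<bar>"
    using c by (simp add: \<epsilon>_def field_simps)
  then have "w \<bullet> v + b = \<epsilon> * (\<bar>w \<bullet> x + b\<bar> + (w \<bullet> x + b))"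
    using wv by (simp add: distrib_left)
  then have "0 \<le> w \<bullet> v + b"
    using \<epsilon> by simp
  moreover have "v \<in> C"
    unfolding v_def using C \<epsilon> by (intro convexD) auto
  ultimately have "(v, a * (w \<bullet> v + b), z) \<in> S" "(c, a * (w \<bullet> c + b), z) \<in> S"
    using mem c C by auto
  \<comment> \<open>Extrapolating from \<open>c\<close> through \<open>v\<close> by the factor
    \<open>1 / \<epsilon>\<close> returns to \<open>x\<close>; this may leave the convex hull but
    not the affine set \<open>S\<close>.\<close>
  then have "(1 - 1 / \<epsilon>) *\<^sub>R (c, a * (w \<bullet> c + b), z) + (1 / \<epsilon>) *\<^sub>R (v, a * (w \<bullet> v + b), z) \<in> S"
    using S by (intro mem_affine) auto
  moreover have "(1 - 1 / \<epsilon>) *\<^sub>R (c, a * (w \<bullet> c + b), z) + (1 / \<epsilon>) *\<^sub>R (v, a * (w \<bullet> v + b), z)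
      = (x, a * (w \<bullet> x + b), z)"
    using \<epsilon> by (simp add: wv v_def algebra_simps)
  ultimately show ?thesis
    by simp
qed

locale relu_box =
  fixes L U w :: "real ^ 'n" and b :: real
  assumes pos: "\<exists>x \<in> cbox L U. 0 < w \<bullet> x + b"
    and neg: "\<exists>x \<in> cbox L U. w \<bullet> x + b < 0"
begin

abbreviation "Q \<equiv> relu_relaxation L U w b"
abbreviation "lo \<equiv> breve_L w L U"
abbreviation "up \<equiv> breve_U w L U"

text \<open>Over the box, \<open>f\<close> is minimal at \<open>lo\<close> and maximal at
  \<open>up\<close>, so these points inherit the two assumed signs.\<close>

lemma lo: "lo \<in> cbox L U" "w \<bullet> lo + b < 0" and up: "up \<in> cbox L U" "0 < w \<bullet> up + b"
proof -
  show "lo \<in> cbox L U" "up \<in> cbox L U"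
    using pos by (auto intro!: breve_in_cbox)
  show "w \<bullet> lo + b < 0" "0 < w \<bullet> up + b"
    using pos neg inner_breve_bounds[of _ L U w] by force+
qed

text \<open>A zero of \<open>f\<close> is feasible for both values of \<open>z\<close> and thus
  links the two slices. Its position strictly between \<open>lo\<close> and \<open>up\<close> makes
  (a) computable there.\<close>

lemma obtains_zero:
  obtains m t where "m \<in> cbox L U" "w \<bullet> m + b = 0" "0 < t" "t < 1"
    "m = (1 - t) *\<^sub>R lo + t *\<^sub>R up"
proof -
  define t where "t = - (w \<bullet> lo + b) / ((w \<bullet> up + b) - (w \<bullet> lo + b))"
  have t: "0 < t" "t < 1"
    using lo up by (auto simp: t_def field_simps)
  have "w \<bullet> ((1 - t) *\<^sub>R lo + t *\<^sub>R up) + b = (w \<bullet> lo + b) + t * ((w \<bullet> up + b) - (w \<bullet> lo + b))"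
    by (simp add: algebra_simps)
  also have "\<dots> = 0"
    using lo up by (simp add: t_def)
  moreover have "(1 - t) *\<^sub>R lo + t *\<^sub>R up \<in> cbox L U"
    using lo up t by (intro convexD convex_box) auto
  ultimately show ?thesis
    using t that by metis
qed

text \<open>All binary points with \<open>z = 1\<close> are tight, and their hull contains the graph
  of \<open>f\<close> over the whole box. The zero \<open>m\<close> is tight at \<open>z = 0\<close>
  as well, which adds the direction of the \<open>z\<close>-axis.\<close>

lemma facet_lower: "facet_defining Q (\<lambda>(x, y, z). w \<bullet> x + b) (\<lambda>(x, y, z). y)"
proof (rule facet_definingI[where e = "(0, 1, 0)"])
  let ?g = "\<lambda>(x, y, z :: real). w \<bullet> x + b" and ?h = "\<lambda>(x, y, z :: real). y"
  let ?A = "affine hull {p \<in> binary_points Q. ?g p = ?h p}"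
  show "valid_inequality Q ?g ?h"
    by (auto simp: valid_inequality_def binary_points_relu_relaxation)
  have "{p. ?g p = ?h p} = {p. (w, -1, 0) \<bullet> p = - b}"
    by auto
  then show "affine {p. ?g p = ?h p}"
    by (simp add: affine_hyperplane)
  show "\<exists>p \<in> binary_points Q. ?g p \<noteq> ?h p"
    using lo by (intro bexI[of _ "(lo, 0, 0)"]) (auto simp: binary_points_relu_relaxation)
  obtain m where m: "m \<in> cbox L U" "w \<bullet> m + b = 0"
    using obtains_zero by metis
  have A1: "(x, w \<bullet> x + b, 1) \<in> ?A" if "x \<in> cbox L U" for x
  proof -
    have mem: "(v, 1 * (w \<bullet> v + b), 1) \<in> ?A" if "v \<in> cbox L U" "0 \<le> w \<bullet> v + b" for v
      using that by (intro hull_inc) (auto simp: binary_points_relu_relaxation)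
    have "(x, 1 * (w \<bullet> x + b), 1) \<in> ?A"
      by (rule affine_contains_of_nonneg[OF affine_affine_hull up(2) convex_box(1) up(1) that mem])
    then show ?thesis
      by simp
  qed
  have A0: "(m, 0, 0) \<in> ?A"
    using m by (auto simp: binary_points_relu_relaxation intro!: hull_inc)
  fix q assume "q \<in> binary_points Q"
  then obtain x y z where q: "q = (x, y, z)" "x \<in> cbox L U" "z = 0 \<or> z = 1"
    by (auto simp: binary_points_relu_relaxation)
  \<comment> \<open>The added difference is \<open>(0, 0, -1)\<close>, since \<open>f\<close>
    vanishes at \<open>m\<close>.\<close>
  have "(x, w \<bullet> x + b, 1) + 1 *\<^sub>R ((m, 0, 0) - (m, w \<bullet> m + b, 1)) \<in> ?A"
    using q(2) m(1) by (intro mem_affine_3_minus affine_affine_hull A0 A1)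
  then have "(x, w \<bullet> x + b, z) \<in> ?A"
    using q A1[of x] m by auto
  then show "\<exists>s. q + s *\<^sub>R (0, 1, 0) \<in> ?A"
    using q by (intro exI[of _ "w \<bullet> x + b - y"]) simp
qed

text \<open>Inequality (a) is tight at \<open>z = 0\<close> when \<open>x\<close> agrees with
  \<open>lo\<close> on \<open>I\<close>, and at \<open>z = 1\<close> when \<open>x\<close> agrees
  with \<open>up\<close> off \<open>I\<close>. One slice leaves the coordinates off \<open>I\<close>
  free, the other those in \<open>I\<close>; the point \<open>c\<close>, common to both patterns,
  glues them together.\<close>

lemma facet_upper: "facet_defining Q (\<lambda>(x, y, z). y) (\<lambda>(x, y, z). relu_upper L U w b I x z)"
proof (rule facet_definingI[where e = "(0, 1, 0)"])
  let ?g = "\<lambda>(x, y, z). y" and ?h = "\<lambda>(x, y, z). relu_upper L U w b I x z"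
  let ?T = "{p \<in> binary_points Q. ?g p = ?h p}"
  let ?A = "affine hull ?T"
  show "valid_inequality Q ?g ?h"
    by (auto simp: valid_inequality_def binary_points_def relu_relaxation_def)
  obtain a \<beta> where "\<And>x y z. y - relu_upper L U w b I x z = a \<bullet> (x, y, z) - \<beta>"
    using relu_upper_affine by blast
  then have "y = relu_upper L U w b I x z \<longleftrightarrow> a \<bullet> (x, y, z) = \<beta>" for x y z
    by (metis diff_eq_diff_eq)
  then have "{p. ?g p = ?h p} = {p. a \<bullet> p = \<beta>}"
    by auto
  then show "affine {p. ?g p = ?h p}"
    by (simp add: affine_hyperplane)

  obtain m t where m: "m \<in> cbox L U" "w \<bullet> m + b = 0"
    and t: "0 < t" "t < 1" "m = (1 - t) *\<^sub>R lo + t *\<^sub>R up"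
    using obtains_zero by metis
  show "\<exists>p \<in> binary_points Q. ?g p \<noteq> ?h p"
  proof (rule ccontr)
    assume "\<not> ?thesis"
    then have *: "?g p = ?h p" if "p \<in> binary_points Q" for p
      using that by blast
    \<comment> \<open>Tightness at \<open>m\<close> for both values of \<open>z\<close> would make
      the spread of \<open>f\<close> between \<open>lo\<close> and \<open>up\<close> vanish on
      \<open>I\<close> and on \<open>-I\<close>, as \<open>t\<close> and \<open>1 - t\<close> are
      nonzero.\<close>
    have "relu_upper L U w b I m 0 = t * (\<Sum>i\<in>I. w $ i * up $ i - w $ i * lo $ i)"
      by (simp add: relu_upper_0 t(3) sum_distrib_left algebra_simps)
    moreover have "relu_upper L U w b I m 1 = (1 - t) * (\<Sum>i\<in>-I. w $ i * up $ i - w $ i * lo $ i)"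
      unfolding relu_upper_1 m(2) by (simp add: t(3) sum_distrib_left algebra_simps)
    moreover have "(m, 0, 0) \<in> binary_points Q" "(m, 0, 1) \<in> binary_points Q"
      using m by (auto simp: binary_points_relu_relaxation)
    ultimately have "(\<Sum>i\<in>I. w $ i * up $ i - w $ i * lo $ i) = 0"
      "(\<Sum>i\<in>-I. w $ i * up $ i - w $ i * lo $ i) = 0"
      using * t by fastforce+
    then have "(\<Sum>i\<in>UNIV. w $ i * up $ i - w $ i * lo $ i) = 0"
      using sum.union_disjoint[of I "-I" "\<lambda>i. w $ i * up $ i - w $ i * lo $ i"] by simp
    then have "w \<bullet> up = w \<bullet> lo"
      by (simp add: inner_vec_def sum_subtractf)
    then show False
      using lo up by simp
  qed

  let ?C0 = "{x \<in> cbox L U. \<forall>i\<in>I. x $ i = lo $ i}"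
  let ?C1 = "{x \<in> cbox L U. \<forall>i\<in>-I. x $ i = up $ i}"
  have "convex {x :: real ^ 'n. \<forall>i\<in>J. x $ i = c $ i}" for J c
    by (auto simp: convex_def algebra_simps) (metis distrib_right mult_1)
  then have conv: "convex ?C0" "convex ?C1"
    using convex_Int[OF convex_box(1), of _ L U] by (simp_all add: Collect_conj_eq)
  have A0: "(x, 0, 0) \<in> ?A" if "x \<in> ?C0" for x
  proof -
    \<comment> \<open>The factor 0 keeps \<open>y = 0\<close>, and negating \<open>w\<close> and
      \<open>b\<close> turns the condition \<open>f v \<le> 0\<close> into the required
      nonnegativity.\<close>
    have mem: "(v, 0 * (- w \<bullet> v + - b), 0) \<in> ?A" if "v \<in> ?C0" "0 \<le> - w \<bullet> v + - b" for v
      using that by (intro hull_inc) (auto simp: binary_points_relu_relaxation relu_upper_0)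
    have "(x, 0 * (- w \<bullet> x + - b), 0) \<in> ?A"
      by (rule affine_contains_of_nonneg[OF affine_affine_hull _ conv(1) _ that mem]) (use lo in auto)
    then show ?thesis
      by simp
  qed
  have A1: "(x, w \<bullet> x + b, 1) \<in> ?A" if "x \<in> ?C1" for x
  proof -
    have mem: "(v, 1 * (w \<bullet> v + b), 1) \<in> ?A" if "v \<in> ?C1" "0 \<le> w \<bullet> v + b" for v
      using that by (intro hull_inc) (auto simp: binary_points_relu_relaxation relu_upper_1)
    have "(x, 1 * (w \<bullet> x + b), 1) \<in> ?A"
      by (rule affine_contains_of_nonneg[OF affine_affine_hull _ conv(2) _ that mem]) (use up in auto)
    then show ?thesis
      by simp
  qed
  fix q assume "q \<in> binary_points Q"
  then obtain x y z where q: "q = (x, y, z)" "x \<in> cbox L U" "z = 0 \<or> z = 1"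
    by (auto simp: binary_points_relu_relaxation)
  define x0 where "x0 = (\<chi> i. if i \<in> I then lo $ i else x $ i)"
  define x1 where "x1 = (\<chi> i. if i \<in> I then x $ i else up $ i)"
  define c where "c = (\<chi> i. if i \<in> I then lo $ i else up $ i)"
  have C: "x0 \<in> ?C0" "x1 \<in> ?C1" "c \<in> ?C0" "c \<in> ?C1"
    using lo up q by (auto simp: x0_def x1_def c_def mem_box_cart)
  have x: "x0 + (x1 - c) = x"
    by (auto simp: x0_def x1_def c_def vec_eq_iff)
  \<comment> \<open>Subtracting \<open>c\<close> at level \<open>z = 1\<close> lands at level 0, and
    subtracting it at level \<open>z = 0\<close> lands at level 1, so both levels are reached above
    the same \<open>x\<close>.\<close>
  note combine = mem_affine_3_minus[OF affine_affine_hull A0[OF C(1)] A1[OF C(2)], of _ 1]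
  have tight: "(x, w \<bullet> x1 - w \<bullet> c, 0) \<in> ?A" "(x, w \<bullet> x1 + b, 1) \<in> ?A"
    using combine[OF A1[OF C(4)]] combine[OF A0[OF C(3)]] by (simp_all add: x)
  show "\<exists>s. q + s *\<^sub>R (0, 1, 0) \<in> ?A"
    using q(3)
  proof
    assume "z = 0"
    then show ?thesis
      using tight(1) by (intro exI[of _ "w \<bullet> x1 - w \<bullet> c - y"]) (simp add: q(1))
  next
    assume "z = 1"
    then show ?thesis
      using tight(2) by (intro exI[of _ "w \<bullet> x1 + b - y"]) (simp add: q(1))
  qed
qed

end

theorem proposition12:
  fixes L U w :: "real ^ 'n" and b :: real and f :: "real ^ 'n \<Rightarrow> real"
  assumes f: "\<And>x. f x = w \<bullet> x + b"
    and pos: "\<exists>x \<in> cbox L U. f x > 0"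
    and neg: "\<exists>x \<in> cbox L U. f x < 0"
  shows "ideal_mip_formulation (relu_relaxation L U w b)
           {(x, y). x \<in> cbox L U \<and> y = max 0 (f x)} \<and>
         (\<forall>I. facet_defining (relu_relaxation L U w b)
                (\<lambda>(x, y, z). y) (\<lambda>(x, y, z). relu_upper L U w b I x z)) \<and>
         facet_defining (relu_relaxation L U w b)
           (\<lambda>(x, y, z). w \<bullet> x + b) (\<lambda>(x, y, z). y)"
proof -
  interpret relu_box L U w b
    using pos neg by unfold_locales (auto simp: f)
  show ?thesis
    using ideal_relu_relaxation facet_upper facet_lower by (simp add: f)
qed

end
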